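(* Let $G=(A,B,E)$, $(w_e)_{e\in E}$, $(p_e)_{e\in E}$ and the order $e_1,\dots,e_{|E|}$ be an instance of the online bipartite stochastic matching problem under edge arrivals, let $\mathbf{x}$ be an optimal solution of the linear program (LP-E), and let $M$ be the output of the Edge Rounding Procedure run with $\mathbf{x}$. Then $M$ is a matching of $G$ and $$\mathbb{E}\Big[\sum_{e\in M}w_e\Big]\;\ge\;\mathrm{OPT}/2 .$$
   Context: Problem (edge arrivals). We are given a bipartite graph $G=(A,B,E)$, non-negative edge weights $w_e$, a probability $p_e\in[0,1]$ for each edge, and a fixed order $e_1,\dots,e_{|E|}$ of $E$. Edges are written $(v,u)$ with $v\in A$, $u\in B$. At time $t$ the edge $e_t$ is realized (arrives) with probability $p_{e_t}$, independently of everything else; if it arrives, an online algorithm must irrevocably decide whether to add it to its matching (only if both endpoints are currently unmatched). An online algorithm knows $G,w,p$ and the order, may use unlimited computation and randomness, but its decision at time $t$ depends only on the realizations of $e_1,\dots,e_t$ (and its own randomness). $\mathrm{OPT}$ denotes the maximum, over all online algorithms, of the expected total weight of the matching produced. For edges $e,e'$ write $e'<e$ if $e'$ comes before $e$ in the order. LP-E: maximize $\sum_{e}w_ex_e$ subject to $\sum_{e\ni z}x_e\le1$ for all $z\in A\cup B$; $p_e\big(1-\sum_{e'\ni v,\,e'<e}x_{e'}\big)\ge x_e$ and $p_e\big(1-\sum_{e'\ni u,\,e'<e}x_{e'}\big)\ge x_e$ for all $e=(v,u)\in E$; $x_e\ge0$. Edge Rounding Procedure (input: a solution $\mathbf{x}$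 of LP-E). Start with $M=\emptyset$ and all vertices marked alive. For $t=1,\dots,|E|$: let $e_t=(v,u)$; set $\alpha_u=\sum_{e\ni u,\,e<e_t}x_e$ and $\alpha_v=\sum_{e\ni v,\,e<e_t}x_e$; let $b$ be a Bernoulli variable equal to $1$ with probability $\frac{x_{e_t}}{p_{e_t}(1-\alpha_u)}$; if $u$ is alive, $e_t$ is realized and $b=1$, then: if $v$ is also alive, with probability $\frac{1}{2-\alpha_v}$ add $e_t$ to $M$ and mark $v$ dead; and (in any case) mark $u$ dead. All random choices are independent. Output $M$. *)

theory Defs
  imports "HOL-Probability.Probability"
begin

type_synonym 'v edge = "'v \<times> 'v"

definition incident :: "'v \<Rightarrow> 'v edge \<Rightarrow> bool" where
  "incident z e \<longleftrightarrow> z = fst e \<or> z = snd e"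

definition is_matching :: "'v edge set \<Rightarrow> 'v edge set \<Rightarrow> bool" where
  "is_matching E M \<longleftrightarrow> M \<subseteq> E \<and>
     (\<forall>e\<in>M. \<forall>e'\<in>M. e \<noteq> e' \<longrightarrow> \<not> (\<exists>z. incident z e \<and> incident z e'))"

definition unmatched :: "'v edge set \<Rightarrow> 'v \<Rightarrow> bool" where
  "unmatched M z \<longleftrightarrow> (\<forall>e\<in>M. \<not> incident z e)"

text \<open>
  The list \<open>es\<close> enumerates the edge set in arrival order, with indices starting at 0. An edge
  \<open>(v, u)\<close> has \<open>v \<in> A\<close> and \<open>u \<in> B\<close>.
\<close>

definition instance_E ::
    "'v set \<Rightarrow> 'v set \<Rightarrow> 'v edge list \<Rightarrow> ('v edge \<Rightarrow> real) \<Rightarrow> ('v edge \<Rightarrow> real) \<Rightarrow> bool" where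
  "instance_E A B es w p \<longleftrightarrow>
     finite A \<and> finite B \<and> A \<inter> B = {} \<and> set es \<subseteq> A \<times> B \<and> distinct es \<and>
     (\<forall>e\<in>set es. 0 \<le> w e) \<and> (\<forall>e\<in>set es. 0 \<le> p e \<and> p e \<le> 1)"

text \<open>
  \<open>load es x t z\<close> is the total \<open>x\<close>-value of the edges at \<open>z\<close> that precede \<open>es ! t\<close>.
\<close>

definition load :: "'v edge list \<Rightarrow> ('v edge \<Rightarrow> real) \<Rightarrow> nat \<Rightarrow> 'v \<Rightarrow> real" where
  "load es x t z = (\<Sum>e | e \<in> set (take t es) \<and> incident z e. x e)"

definition feasible_LPE ::
    "'v set \<Rightarrow> 'v set \<Rightarrow> 'v edge list \<Rightarrow> ('v edge \<Rightarrow> real) \<Rightarrow> ('v edge \<Rightarrow> real) \<Rightarrow> bool" where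
  "feasible_LPE A B es p x \<longleftrightarrow>
     (\<forall>z\<in>A \<union> B. (\<Sum>e | e \<in> set es \<and> incident z e. x e) \<le> 1) \<and>
     (\<forall>t<length es. p (es ! t) * (1 - load es x t (fst (es ! t))) \<ge> x (es ! t)) \<and>
     (\<forall>t<length es. p (es ! t) * (1 - load es x t (snd (es ! t))) \<ge> x (es ! t)) \<and>
     (\<forall>e\<in>set es. x e \<ge> 0)"

definition optimal_LPE ::
    "'v set \<Rightarrow> 'v set \<Rightarrow> 'v edge list \<Rightarrow> ('v edge \<Rightarrow> real) \<Rightarrow> ('v edge \<Rightarrow> real) \<Rightarrow>
     ('v edge \<Rightarrow> real) \<Rightarrow> bool" where
  "optimal_LPE A B es w p x \<longleftrightarrow> feasible_LPE A B es p x \<and>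
     (\<forall>y. feasible_LPE A B es p y \<longrightarrow> (\<Sum>e\<in>set es. w e * y e) \<le> (\<Sum>e\<in>set es. w e * x e))"

text \<open>
  A deterministic online algorithm is a function \<open>d\<close> that receives at time \<open>t\<close> the list of
  realizations of the edges up to and including \<open>es ! t\<close> and says whether to take \<open>es ! t\<close>.
  Its own past decisions are functions of that list. The state consists of the realizations
  seen so far and the current matching.
\<close>

primrec online_state ::
    "(bool list \<Rightarrow> bool) \<Rightarrow> 'v edge list \<Rightarrow> ('v edge \<Rightarrow> real) \<Rightarrow> nat \<Rightarrow>
     (bool list \<times> 'v edge set) pmf" where
  "online_state d es p 0 = return_pmf ([], {})"
| "online_state d es p (Suc t) =
     do {
       (h, M) \<leftarrow> online_state d es p t;
       let (v, u) = es ! t;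
       realized \<leftarrow> bernoulli_pmf (p (v, u));
       let h' = h @ [realized];
       return_pmf
         (h', if realized \<and> unmatched M v \<and> unmatched M u \<and> d h' then insert (v, u) M else M)
     }"

definition online_output ::
    "(bool list \<Rightarrow> bool) \<Rightarrow> 'v edge list \<Rightarrow> ('v edge \<Rightarrow> real) \<Rightarrow> 'v edge set pmf" where
  "online_output d es p = map_pmf snd (online_state d es p (length es))"

text \<open>
  A randomized online algorithm draws a seed \<open>s\<close>, independently of the realizations, from an
  arbitrary probability space \<open>S\<close> on the reals and then runs the deterministic algorithm \<open>d s\<close>.
  A real seed can encode any countable family of random variables with values in standard Borel
  spaces, so all the randomness used over time may be drawn at the start.
\<close>

definition online_algorithm :: "real measure \<Rightarrow> (real \<Rightarrow> bool list \<Rightarrow> bool) \<Rightarrow> bool" where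
  "online_algorithm S d \<longleftrightarrow> prob_space S \<and> (\<forall>h. Measurable.pred S (\<lambda>s. d s h))"

definition online_value ::
    "'v edge list \<Rightarrow> ('v edge \<Rightarrow> real) \<Rightarrow> ('v edge \<Rightarrow> real) \<Rightarrow>
     real measure \<Rightarrow> (real \<Rightarrow> bool list \<Rightarrow> bool) \<Rightarrow> real" where
  "online_value es w p S d =
     (\<integral>s. measure_pmf.expectation (online_output (d s) es p) (\<lambda>M. \<Sum>e\<in>M. w e) \<partial>S)"

definition OPT :: "'v edge list \<Rightarrow> ('v edge \<Rightarrow> real) \<Rightarrow> ('v edge \<Rightarrow> real) \<Rightarrow> real" where
  "OPT es w p = Sup {online_value es w p S d | S d. online_algorithm S d}"

text \<open>
  The state consists of the current edge set and the set of vertices still alive. For feasible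
  \<open>x\<close> the parameters of all Bernoulli variables lie in \<open>[0, 1]\<close>; if \<open>p e * (1 - \<alpha>\<^sub>u) = 0\<close>, then
  \<open>x e = 0\<close>, and the convention \<open>0 / 0 = 0\<close> makes \<open>b\<close> false, so such an edge is never taken.
\<close>

primrec rounding_state ::
    "'v set \<Rightarrow> 'v set \<Rightarrow> 'v edge list \<Rightarrow> ('v edge \<Rightarrow> real) \<Rightarrow> ('v edge \<Rightarrow> real) \<Rightarrow> nat \<Rightarrow>
     ('v edge set \<times> 'v set) pmf" where
  "rounding_state A B es p x 0 = return_pmf ({}, A \<union> B)"
| "rounding_state A B es p x (Suc t) =
     do {
       (M, alive) \<leftarrow> rounding_state A B es p x t;
       let (v, u) = es ! t;
       let \<alpha>\<^sub>u = load es x t u;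
       let \<alpha>\<^sub>v = load es x t v;
       realized \<leftarrow> bernoulli_pmf (p (v, u));
       b \<leftarrow> bernoulli_pmf (x (v, u) / (p (v, u) * (1 - \<alpha>\<^sub>u)));
       c \<leftarrow> bernoulli_pmf (1 / (2 - \<alpha>\<^sub>v));
       return_pmf
         (if u \<in> alive \<and> realized \<and> b
          then if v \<in> alive \<and> c then (insert (v, u) M, alive - {v} - {u}) else (M, alive - {u})
          else (M, alive))
     }"

definition edge_rounding ::
    "'v set \<Rightarrow> 'v set \<Rightarrow> 'v edge list \<Rightarrow> ('v edge \<Rightarrow> real) \<Rightarrow> ('v edge \<Rightarrow> real) \<Rightarrow>
     'v edge set pmf" where
  "edge_rounding A B es p x = map_pmf fst (rounding_state A B es p x (length es))"

end

theory Submission imports Defs begin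

text \<open>
  For a deterministic online algorithm, the probabilities of matching the individual edges form
  a feasible solution of LP-E, because the realization of an edge is independent of the earlier
  events that determine whether its endpoints are still free. Hence the LP
  value bounds \<open>OPT\<close>. The rounding procedure, on the other hand, matches each edge \<open>e\<close> with
  probability exactly \<open>x e / 2\<close>: a vertex \<open>u \<in> B\<close> is alive with probability \<open>1 - \<alpha>\<^sub>u\<close>, a vertex
  \<open>v \<in> A\<close> with probability \<open>1 - \<alpha>\<^sub>v / 2\<close>, and the two events are independent when \<open>(v, u)\<close> arrives.
\<close>

section \<open>Expectations over finitely supported distributions\<close>

lemma expectation_pmf_cong:
  fixes f g :: "'a \<Rightarrow> real"
  assumes "\<And>a. a \<in> set_pmf P \<Longrightarrow> f a = g a"
  shows "measure_pmf.expectation P f = measure_pmf.expectation P g"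
  by (rule integral_cong_AE) (auto simp: AE_measure_pmf_iff assms)

lemma expectation_bind_pmf_finite:
  fixes g :: "'b \<Rightarrow> real"
  assumes "finite (set_pmf P)" "\<And>a. finite (set_pmf (F a))"
  shows "measure_pmf.expectation (bind_pmf P F) g
    = measure_pmf.expectation P (\<lambda>a. measure_pmf.expectation (F a) g)"
  using assms
  by (subst pmf_expectation_bind[OF assms(1)], simp_all)
     (subst integral_measure_pmf[OF assms(1)], simp_all)

text \<open>Linearity of expectation: for both procedures the expected weight is thereby reduced to
  the matching probabilities of single edges.\<close>

lemma expectation_sum_random_set:
  fixes w :: "'a \<Rightarrow> real"
  assumes "finite (set_pmf P)" "finite E" "\<And>M. M \<in> set_pmf P \<Longrightarrow> M \<subseteq> E"
  shows "measure_pmf.expectation P (\<lambda>M. \<Sum>e\<in>M. w e)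
    = (\<Sum>e\<in>E. w e * measure_pmf.expectation P (\<lambda>M. of_bool (e \<in> M)))"
proof -
  have "measure_pmf.expectation P (\<lambda>M. \<Sum>e\<in>M. w e)
      = measure_pmf.expectation P (\<lambda>M. \<Sum>e\<in>E. w e * of_bool (e \<in> M))"
  proof (rule expectation_pmf_cong)
    fix M assume "M \<in> set_pmf P"
    then have "M \<subseteq> E" by (rule assms)
    then have "E \<inter> M = M" by blast
    then show "(\<Sum>e\<in>M. w e) = (\<Sum>e\<in>E. w e * of_bool (e \<in> M))"
      using sum.inter_restrict[OF assms(2), of w M]
      by (simp add: of_bool_def if_distrib cong: if_cong)
  qed
  also have "\<dots> = (\<Sum>e\<in>E. measure_pmf.expectation P (\<lambda>M. w e * of_bool (e \<in> M)))"
    by (rule Bochner_Integration.integral_sum) (rule integrable_measure_pmf_finite[OF assms(1)])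
  finally show ?thesis by simp
qed

lemma finite_set_bernoulli_pmf: "finite (set_pmf (bernoulli_pmf q))"
  by (rule finite_subset[OF subset_UNIV]) simp

section \<open>Matchings and prefixes of the arrival order\<close>

lemma is_matching_insert:
  assumes "is_matching E M" "unmatched M v" "unmatched M u"
  shows "is_matching (insert (v, u) E) (insert (v, u) M)"
  using assms unfolding is_matching_def unmatched_def incident_def by auto

lemma set_take_Suc:
  "t < length es \<Longrightarrow> set (take (Suc t) es) = insert (es ! t) (set (take t es))"
  by (simp add: take_Suc_conv_app_nth)

lemma nth_notin_set_take:
  "distinct es \<Longrightarrow> t < length es \<Longrightarrow> es ! t \<notin> set (take t es)"
  by (auto simp: in_set_conv_nth nth_eq_iff_index_eq)

lemma load_Suc:
  assumes "distinct es" "t < length es"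
  shows "load es x (Suc t) z
    = load es x t z + (if incident z (es ! t) then x (es ! t) else 0)"
proof -
  have "{e. e \<in> set (take (Suc t) es) \<and> incident z e}
      = (if incident z (es ! t) then insert (es ! t) {e. e \<in> set (take t es) \<and> incident z e}
         else {e. e \<in> set (take t es) \<and> incident z e})"
    by (auto simp: set_take_Suc[OF assms(2)])
  then show ?thesis
    using nth_notin_set_take[OF assms] by (simp add: load_def)
qed

subsection \<open>The linear program bounds every online algorithm\<close>

lemma finite_set_online_state: "finite (set_pmf (online_state d es p t))"
  by (induction t) (auto simp: Let_def finite_set_bernoulli_pmf split: prod.splits)

lemma online_state_matching:
  assumes "t \<le> length es" "(h, M) \<in> set_pmf (online_state d es p t)"
  shows "is_matching (set (take t es)) M"
  using assms
proof (induction t arbitrary: h M)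
  case 0
  then show ?case by (simp add: is_matching_def)
next
  case (Suc t)
  obtain v u where vu: "es ! t = (v, u)" by fastforce
  from Suc.prems(2) obtain h0 M0 r where 0: "(h0, M0) \<in> set_pmf (online_state d es p t)"
    and M: "M = (if r \<and> unmatched M0 v \<and> unmatched M0 u \<and> d (h0 @ [r])
      then insert (v, u) M0 else M0)"
    by (force simp: vu Let_def)
  from Suc 0 have IH: "is_matching (set (take t es)) M0" by simp
  moreover have "set (take (Suc t) es) = insert (v, u) (set (take t es))"
    using Suc.prems by (simp add: set_take_Suc vu)
  moreover have "is_matching (insert (v, u) (set (take t es))) M0"
    using IH by (auto simp: is_matching_def)
  ultimately show ?case
    using is_matching_insert[OF IH, of v u] by (simp add: M)
qed

text \<open>The realization is drawn afresh after the state, so conditioning on the state splits the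
  expectation; this is where independence enters.\<close>

lemma online_expectation_Suc:
  fixes g :: "bool list \<times> 'v edge set \<Rightarrow> real"
  assumes "es ! t = (v, u)" "0 \<le> p (v, u)" "p (v, u) \<le> 1"
  shows "measure_pmf.expectation (online_state d es p (Suc t)) g
    = measure_pmf.expectation (online_state d es p t) (\<lambda>(h, M).
        p (v, u) * g (h @ [True], if unmatched M v \<and> unmatched M u \<and> d (h @ [True])
                         then insert (v, u) M else M)
        + (1 - p (v, u)) * g (h @ [False], M))"
  unfolding online_state.simps
  apply (subst expectation_bind_pmf_finite[OF finite_set_online_state])
   apply (auto simp: Let_def assms finite_set_bernoulli_pmf split: prod.splits)[1]
  apply (rule Bochner_Integration.integral_cong[OF refl])
  apply (clarsimp simp: assms Let_def)
  apply (subst expectation_bind_pmf_finite)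
    apply (simp_all add: finite_set_bernoulli_pmf expectation_bind_pmf_finite assms mult.commute)
  done

context
  fixes A B :: "'v set" and es :: "'v edge list" and w p :: "'v edge \<Rightarrow> real"
  assumes inst: "instance_E A B es w p"
begin

lemma distinct_edges: "distinct es"
  using inst by (simp add: instance_E_def)

lemma edge_prob: "e \<in> set es \<Longrightarrow> 0 \<le> p e" "e \<in> set es \<Longrightarrow> p e \<le> 1"
  using inst by (auto simp: instance_E_def)

lemma edge_weight: "e \<in> set es \<Longrightarrow> 0 \<le> w e"
  using inst by (auto simp: instance_E_def)

lemma nth_edge:
  assumes "t < length es" "es ! t = (v, u)"
  shows "(v, u) \<in> set es" "v \<in> A" "u \<in> B" "v \<noteq> u"
proof -
  show "(v, u) \<in> set es" using nth_mem[OF assms(1)] assms(2) by simp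
  then show "v \<in> A" "u \<in> B" "v \<noteq> u" using inst by (auto simp: instance_E_def)
qed

text \<open>The candidate solution of LP-E is the case \<open>t = length es\<close>; the time index
  allows induction along the run.\<close>

definition match_prob :: "(bool list \<Rightarrow> bool) \<Rightarrow> nat \<Rightarrow> 'v edge \<Rightarrow> real" where
  "match_prob d t e
    = measure_pmf.expectation (online_state d es p t) (\<lambda>s. of_bool (e \<in> snd s))"

lemma match_prob_Suc:
  assumes "t < length es" "e \<noteq> es ! t"
  shows "match_prob d (Suc t) e = match_prob d t e"
proof -
  obtain v u where vu: "es ! t = (v, u)" by fastforce
  have p: "0 \<le> p (v, u)" "p (v, u) \<le> 1" using nth_edge[OF assms(1) vu] edge_prob by auto
  show ?thesis
    unfolding match_prob_def online_expectation_Suc[where p = p, OF vu p]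
    using assms(2)
    by (intro Bochner_Integration.integral_cong) (auto simp: vu algebra_simps split: prod.splits)
qed

lemma match_prob_stable:
  assumes "t \<le> n" "n \<le> length es" "e \<in> set (take t es)"
  shows "match_prob d n e = match_prob d t e"
  using assms(1,2)
proof (induction n rule: dec_induct)
  case base
  show ?case ..
next
  case (step n)
  have "e \<in> set (take n es)"
    using set_take_subset_set_take[OF \<open>t \<le> n\<close>, of es] assms(3) by blast
  then have "e \<noteq> es ! n"
    using nth_notin_set_take[OF distinct_edges, of n] step.prems by auto
  then show ?case using match_prob_Suc[of n e d] step by simp
qed

text \<open>A matching has at most one edge at \<open>z\<close>, so the indicator of
  \<open>z\<close> being free is 1 minus the number of matched edges at \<open>z\<close>. Past edges
  keep their probabilities, so the final ones can be used at time \<open>t\<close>.\<close>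

lemma expectation_unmatched:
  assumes "t \<le> length es"
  shows "measure_pmf.expectation (online_state d es p t) (\<lambda>s. of_bool (unmatched (snd s) z))
    = 1 - load es (match_prob d (length es)) t z"
proof -
  let ?P = "online_state d es p t" and ?I = "{e. e \<in> set (take t es) \<and> incident z e}"
  have "measure_pmf.expectation ?P (\<lambda>s. of_bool (unmatched (snd s) z))
     = measure_pmf.expectation ?P (\<lambda>s. 1 - (\<Sum>e\<in>?I. of_bool (e \<in> snd s)) :: real)"
  proof (rule expectation_pmf_cong)
    fix s assume "s \<in> set_pmf ?P"
    then have m: "is_matching (set (take t es)) (snd s)"
      using online_state_matching[OF assms, of "fst s" "snd s"] by simp
    have "(\<Sum>e\<in>?I. of_bool (e \<in> snd s)) = real (card (?I \<inter> snd s))"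
      by (simp add: Int_def)
    moreover have "card (?I \<inter> snd s) = (if unmatched (snd s) z then 0 else 1)"
    proof (cases "unmatched (snd s) z")
      case True
      then have "?I \<inter> snd s = {}" by (auto simp: unmatched_def)
      with True show ?thesis by simp
    next
      case False
      then obtain e where e: "e \<in> snd s" "incident z e" by (auto simp: unmatched_def)
      then have "?I \<inter> snd s = {e}" using m unfolding is_matching_def by blast
      with False show ?thesis by simp
    qed
    ultimately show "of_bool (unmatched (snd s) z) = 1 - (\<Sum>e\<in>?I. of_bool (e \<in> snd s) :: real)"
      by simp
  qed
  also have "\<dots> = 1 - (\<Sum>e\<in>?I. match_prob d t e)"
    by (simp add: match_prob_def integrable_measure_pmf_finite[OF finite_set_online_state]
        del: sum_of_bool_eq)
  also have "(\<Sum>e\<in>?I. match_prob d t e) = (\<Sum>e\<in>?I. match_prob d (length es) e)"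
    using assms by (intro sum.cong) (auto simp: match_prob_stable)
  finally show ?thesis by (simp add: load_def)
qed

text \<open>Taking the edge requires that it is realized and that \<open>z\<close> was free before,
  and these two events are independent.\<close>

lemma match_prob_le:
  assumes "t < length es" "incident z (es ! t)"
  shows "match_prob d (length es) (es ! t)
    \<le> p (es ! t) * (1 - load es (match_prob d (length es)) t z)"
proof -
  obtain v u where vu: "es ! t = (v, u)" by fastforce
  have p: "0 \<le> p (v, u)" "p (v, u) \<le> 1" using nth_edge[OF assms(1) vu] edge_prob by auto
  have "match_prob d (length es) (es ! t) = match_prob d (Suc t) (es ! t)"
    using assms(1) by (intro match_prob_stable) (auto simp: set_take_Suc)
  also have "\<dots> \<le> measure_pmf.expectation (online_state d es p t)
      (\<lambda>s. p (v, u) * of_bool (unmatched (snd s) z))"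
    unfolding match_prob_def online_expectation_Suc[where p = p, OF vu p]
  proof (rule integral_mono_AE)
    show "AE s in measure_pmf (online_state d es p t).
      (case s of (h, M) \<Rightarrow>
        p (v, u) * of_bool (es ! t \<in> snd (h @ [True],
          if unmatched M v \<and> unmatched M u \<and> d (h @ [True]) then insert (v, u) M else M))
        + (1 - p (v, u)) * of_bool (es ! t \<in> snd (h @ [False], M)))
      \<le> p (v, u) * of_bool (unmatched (snd s) z)"
    proof (rule AE_pmfI)
      fix s assume s: "s \<in> set_pmf (online_state d es p t)"
      obtain h M where hM: "s = (h, M)" by fastforce
      \<comment> \<open>The edge is not matched before its arrival, so only the realized branch
        contributes.\<close>
      have "M \<subseteq> set (take t es)"
        using online_state_matching[of t es h M d p] s hM assms(1) by (simp add: is_matching_def)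
      then have "(v, u) \<notin> M"
        using nth_notin_set_take[OF distinct_edges assms(1)] vu by auto
      then show "(case s of (h, M) \<Rightarrow>
        p (v, u) * of_bool (es ! t \<in> snd (h @ [True],
          if unmatched M v \<and> unmatched M u \<and> d (h @ [True]) then insert (v, u) M else M))
        + (1 - p (v, u)) * of_bool (es ! t \<in> snd (h @ [False], M)))
        \<le> p (v, u) * of_bool (unmatched (snd s) z)"
        using p assms(2) by (auto simp: hM vu incident_def)
    qed
  qed (simp_all add: integrable_measure_pmf_finite[OF finite_set_online_state])
  also have "\<dots> = p (es ! t) * (1 - load es (match_prob d (length es)) t z)"
    using assms(1) by (simp add: expectation_unmatched vu)
  finally show ?thesis .
qed

lemma feasible_match_prob: "feasible_LPE A B es p (match_prob d (length es))"
proof -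
  \<comment> \<open>The degree constraint at \<open>z\<close> amounts to nonnegativity of the final
    probability that \<open>z\<close> is free.\<close>
  have "0 \<le> measure_pmf.expectation (online_state d es p (length es))
      (\<lambda>s. of_bool (unmatched (snd s) z) :: real)" for z
    by (rule Bochner_Integration.integral_nonneg) simp
  then have "load es (match_prob d (length es)) (length es) z \<le> 1" for z
    using expectation_unmatched[OF order_refl, of d z] by (metis diff_ge_0_iff_ge)
  moreover have "0 \<le> match_prob d (length es) e" for e
    by (simp add: match_prob_def)
  ultimately show ?thesis
    by (auto simp: feasible_LPE_def load_def[of es _ "length es"] incident_def
        intro!: match_prob_le)
qed

lemma expectation_online_output:
  "measure_pmf.expectation (online_output d es p) (\<lambda>M. \<Sum>e\<in>M. w e)
    = (\<Sum>e\<in>set es. w e * match_prob d (length es) e)"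
  unfolding match_prob_def
  by (subst expectation_sum_random_set[where E = "set es"])
     (auto simp: online_output_def finite_set_online_state is_matching_def
       dest!: online_state_matching[OF order_refl])

text \<open>For a fixed seed the algorithm is deterministic, so its matching probabilities compete
  with \<open>x\<close> in the LP; averaging over the seed preserves the bound.\<close>

lemma OPT_le_LPE:
  assumes "optimal_LPE A B es w p x"
  shows "OPT es w p \<le> (\<Sum>e\<in>set es. w e * x e)"
  unfolding OPT_def
proof (rule cSup_least)
  \<comment> \<open>The algorithm that never takes an edge shows that the supremum is over a
    nonempty set.\<close>
  have "online_algorithm (return borel 0) (\<lambda>_ _. False)"
    by (simp add: online_algorithm_def prob_space_return)
  then show "{online_value es w p S d |S d. online_algorithm S d} \<noteq> {}" by blast
next
  fix r assume "r \<in> {online_value es w p S d |S d. online_algorithm S d}"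
  then obtain S d where r: "r = online_value es w p S d" and alg: "online_algorithm S d" by blast
  interpret prob_space S using alg by (simp add: online_algorithm_def)
  let ?f = "\<lambda>s. measure_pmf.expectation (online_output (d s) es p) (\<lambda>M. \<Sum>e\<in>M. w e)"
  have f: "?f s \<le> (\<Sum>e\<in>set es. w e * x e)" for s
    using assms feasible_match_prob unfolding optimal_LPE_def expectation_online_output by blast
  have "0 \<le> (\<Sum>e\<in>set es. w e * x e)"
    using assms edge_weight
    by (auto simp: optimal_LPE_def feasible_LPE_def intro!: sum_nonneg mult_nonneg_nonneg)
  then show "r \<le> (\<Sum>e\<in>set es. w e * x e)" \<comment> \<open>a non-integrable function has integral \<open>0\<close>\<close>
    unfolding r online_value_def
    using f by (cases "integrable S ?f")
      (auto intro!: integral_le_const simp: not_integrable_integral_eq)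
qed

end

subsection \<open>The rounding procedure matches every edge with half its fractional value\<close>

lemma finite_set_rounding_state: "finite (set_pmf (rounding_state A B es p x t))"
  by (induction t) (auto simp: Let_def finite_set_bernoulli_pmf split: prod.splits)

text \<open>The clause on \<open>alive\<close> carries the induction, since edges are added only
  between alive vertices. Its converse fails: \<open>u\<close> can die without being
  matched.\<close>

lemma rounding_state_matching:
  assumes "t \<le> length es" "(M, alive) \<in> set_pmf (rounding_state A B es p x t)"
  shows "is_matching (set (take t es)) M \<and> (\<forall>z\<in>alive. unmatched M z)"
  using assms
proof (induction t arbitrary: M alive)
  case 0
  then show ?case by (simp add: is_matching_def unmatched_def)
next
  case (Suc t)
  obtain v u where vu: "es ! t = (v, u)" by fastforce
  from Suc.prems(2) obtain M0 a0 r b c where 0: "(M0, a0) \<in> set_pmf (rounding_state A B es p x t)"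
    and M: "(M, alive) = (if u \<in> a0 \<and> r \<and> b
          then if v \<in> a0 \<and> c then (insert (v, u) M0, a0 - {v} - {u}) else (M0, a0 - {u})
          else (M0, a0))"
    by (force simp: vu Let_def)
  from Suc 0 have IH: "is_matching (set (take t es)) M0" "\<forall>z\<in>a0. unmatched M0 z" by auto
  have "set (take (Suc t) es) = insert (v, u) (set (take t es))"
    using Suc.prems by (simp add: set_take_Suc vu)
  moreover have "is_matching (insert (v, u) (set (take t es))) M0"
    using IH by (auto simp: is_matching_def)
  moreover have "\<forall>z\<in>a0 - {v} - {u}. unmatched (insert (v, u) M0) z"
    using IH by (auto simp: unmatched_def incident_def)
  ultimately show ?case
    using IH is_matching_insert[OF IH(1), of v u] M by (auto split: if_splits)
qed

context
  fixes A B :: "'v set" and es :: "'v edge list" and w p x :: "'v edge \<Rightarrow> real"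
  assumes inst: "instance_E A B es w p" and feas: "feasible_LPE A B es p x"
begin

lemma edge_value: "e \<in> set es \<Longrightarrow> 0 \<le> x e"
  using feas by (auto simp: feasible_LPE_def)

lemma load_le_1:
  assumes "z \<in> A \<union> B"
  shows "load es x t z \<le> 1"
proof -
  have "load es x t z \<le> (\<Sum>e | e \<in> set es \<and> incident z e. x e)"
    unfolding load_def by (rule sum_mono2) (auto intro: edge_value dest: in_set_takeD)
  also have "\<dots> \<le> 1" using feas assms by (auto simp: feasible_LPE_def)
  finally show ?thesis .
qed

text \<open>With nonnegativity, the second bound forces \<open>x (v, u) = 0\<close> once the load at
  \<open>u\<close> is 1; this later justifies cancelling \<open>1 - load es x t u\<close>.\<close>

lemma edge_value_le:
  assumes "t < length es" "es ! t = (v, u)"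
  shows "x (v, u) \<le> p (v, u) * (1 - load es x t u)" "x (v, u) \<le> 1 - load es x t u"
proof -
  note e = nth_edge[OF inst assms]
  have "\<forall>t<length es. p (es ! t) * (1 - load es x t (snd (es ! t))) \<ge> x (es ! t)"
    using feas by (simp add: feasible_LPE_def)
  then show *: "x (v, u) \<le> p (v, u) * (1 - load es x t u)" using assms by fastforce
  also have "\<dots> \<le> 1 - load es x t u"
    using mult_right_mono[OF edge_prob(2)[OF inst e(1)], of "1 - load es x t u"]
      load_le_1[of u t] e by simp
  finally show "x (v, u) \<le> 1 - load es x t u" .
qed

text \<open>
  When \<open>u\<close> is alive, the edge \<open>(v, u)\<close> is realized with \<open>b = 1\<close> with probability
  \<open>x (v, u) / (1 - load es x t u)\<close>; this stays correct, with junk value \<open>0\<close>, for zero denominators.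
\<close>

lemma rounding_expectation_Suc:
  fixes g :: "'v edge set \<times> 'v set \<Rightarrow> real"
  assumes t: "t < length es" "es ! t = (v, u)"
  defines "q \<equiv> x (v, u) / (1 - load es x t u)" and "c \<equiv> 1 / (2 - load es x t v)"
  shows "measure_pmf.expectation (rounding_state A B es p x (Suc t)) g
    = measure_pmf.expectation (rounding_state A B es p x t) (\<lambda>(M, a).
        if u \<in> a then
          q * (if v \<in> a then c * g (insert (v, u) M, a - {v} - {u}) + (1 - c) * g (M, a - {u})
               else g (M, a - {u}))
          + (1 - q) * g (M, a)
        else g (M, a))"
proof -
  note e = nth_edge[OF inst t]
  let ?p = "p (v, u)"
  define \<beta> where "\<beta> = x (v, u) / (p (v, u) * (1 - load es x t u))"
  have p: "0 \<le> ?p" "?p \<le> 1" using edge_prob[OF inst e(1)] by auto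
  have "y / D \<le> 1" if "0 \<le> y" "y \<le> D" for y D :: real
    using that by (cases "D = 0") (auto simp: divide_le_eq_1)
  then have b: "0 \<le> \<beta>" "\<beta> \<le> 1"
    using edge_value_le(1)[OF t] edge_value[OF e(1)] by (auto simp: \<beta>_def)
  have c: "0 \<le> c" "c \<le> 1"
    using load_le_1[of v t] e by (auto simp: c_def divide_le_eq_1)
  \<comment> \<open>If \<open>?p = 0\<close>, the LP constraint forces \<open>x (v, u) = 0\<close>;
    if the load is 1, both quotients are 0 by division by zero.\<close>
  have pb: "?p * \<beta> = q"
    using edge_value_le(1)[OF t] edge_value[OF e(1)]
    by (cases "?p = 0"; cases "load es x t u = 1") (auto simp: q_def \<beta>_def)
  \<comment> \<open>The integrand is rewritten as nested averages over \<open>realized\<close>,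
    \<open>b\<close> and \<open>c\<close>, the order in which the procedure draws them.\<close>
  have step: "(\<lambda>(M, a).
        if u \<in> a then
          q * (if v \<in> a then c * g (insert (v, u) M, a - {v} - {u}) + (1 - c) * g (M, a - {u})
               else g (M, a - {u}))
          + (1 - q) * g (M, a)
        else g (M, a)) = (\<lambda>(M, a). ?p * (\<beta> * (c * g (
          if u \<in> a then if v \<in> a then (insert (v, u) M, a - {v} - {u}) else (M, a - {u})
          else (M, a)) + (1 - c) * g (if u \<in> a then (M, a - {u}) else (M, a))) +
          (1 - \<beta>) * g (M, a)) + (1 - ?p) * g (M, a))"
    unfolding pb[symmetric] by (intro ext) (auto simp: algebra_simps)
  show ?thesis
    unfolding step rounding_state.simps
    apply (subst expectation_bind_pmf_finite[OF finite_set_rounding_state])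
     apply (auto simp: Let_def finite_set_bernoulli_pmf split: prod.splits)[1]
    apply (rule Bochner_Integration.integral_cong[OF refl])
    apply (clarsimp simp: t Let_def c_def[symmetric] \<beta>_def[symmetric])
    apply (simp add: expectation_bind_pmf_finite finite_set_bernoulli_pmf p b c
        integral_bernoulli_pmf[OF p] integral_bernoulli_pmf[OF b] integral_bernoulli_pmf[OF c])
    apply (auto simp: algebra_simps)
    done
qed

text \<open>
  A vertex \<open>z \<in> A\<close> dies only through edges \<open>(z, u)\<close>, and the deaths of distinct vertices of \<open>B\<close>
  are independent of each other; so survival of \<open>z\<close> is independent of survival of those
  \<open>u \<in> B\<close> whose edge to \<open>z\<close> is still to come. The factor \<open>1 - load / 2\<close> is the solution of
  \<open>\<beta>\<^sub>t\<^sub>+\<^sub>1 = \<beta>\<^sub>t * (1 - x / (2 - load))\<close>.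
\<close>

lemma expectation_alive:
  assumes "t \<le> length es" "z \<in> A" "U \<subseteq> B" "\<forall>u\<in>U. (z, u) \<notin> set (take t es)"
  shows "measure_pmf.expectation (rounding_state A B es p x t)
      (\<lambda>s. of_bool (z \<in> snd s \<and> U \<subseteq> snd s))
    = (1 - load es x t z / 2) * (\<Prod>u\<in>U. 1 - load es x t u)"
  using assms
proof (induction t arbitrary: U)
  case 0
  then show ?case by (auto simp: load_def)
next
  case (Suc t)
  let ?E = "\<lambda>t. measure_pmf.expectation (rounding_state A B es p x t)"
  obtain v u where vu: "es ! t = (v, u)" by fastforce
  have t: "t < length es" using Suc.prems by simp
  note e = nth_edge[OF inst t vu]
  have AB: "A \<inter> B = {}" and fin: "finite U"
    using inst Suc.prems(3) by (auto simp: instance_E_def intro: finite_subset)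
  have load: "load es x (Suc t) y
      = load es x t y + (if y = v \<or> y = u then x (v, u) else 0)" for y
    using load_Suc[OF distinct_edges[OF inst] t] by (simp add: vu incident_def)
  have new: "(v, u) \<notin> set (take t es)"
    using nth_notin_set_take[OF distinct_edges[OF inst] t] vu by simp
  have U: "\<forall>u\<in>U. (z, u) \<notin> set (take t es)" "u \<in> U \<Longrightarrow> v \<noteq> z"
    using Suc.prems(4) by (auto simp: set_take_Suc[OF t] vu)
  have vU: "v \<notin> U" and zu: "z \<noteq> u" using Suc.prems AB e by auto
  note IH = Suc.IH[OF less_imp_le[OF t] \<open>z \<in> A\<close>]
  let ?q = "x (v, u) / (1 - load es x t u)" and ?c = "1 / (2 - load es x t v)"
  note step = rounding_expectation_Suc[OF t vu]
  \<comment> \<open>For load 1 both sides are 0.\<close>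
  have q: "?q * (1 - load es x t u) = x (v, u)"
    using edge_value_le(2)[OF t vu] edge_value[OF e(1)] by auto
  consider "u \<in> U" | "u \<notin> U" "v = z" | "u \<notin> U" "v \<noteq> z" by blast
  then show ?case
  proof cases
    case 1
    \<comment> \<open>Here \<open>v\<close> differs from \<open>z\<close>, so the only relevant
      change is that \<open>u\<close> survives with probability \<open>1 - ?q\<close>.\<close>
    have "?E (Suc t) (\<lambda>s. of_bool (z \<in> snd s \<and> U \<subseteq> snd s))
        = ?E t (\<lambda>s. (1 - ?q) * of_bool (z \<in> snd s \<and> U \<subseteq> snd s))"
      unfolding step
      by (rule Bochner_Integration.integral_cong[OF refl])
         (use 1 in \<open>auto split: prod.splits\<close>)
    also have "\<dots> = (1 - load es x t z / 2) * ((1 - ?q) * (\<Prod>u\<in>U. 1 - load es x t u))"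
      by (simp add: IH[OF Suc.prems(3) U(1)])
    also have "(1 - ?q) * (\<Prod>u\<in>U. 1 - load es x t u)
        = ((1 - ?q) * (1 - load es x t u)) * (\<Prod>u\<in>U - {u}. 1 - load es x t u)"
      by (simp add: prod.remove[OF fin 1])
    also have "(1 - ?q) * (1 - load es x t u) = 1 - load es x (Suc t) u"
      unfolding left_diff_distrib q by (simp add: load)
    also have "(\<Prod>u\<in>U - {u}. 1 - load es x t u) = (\<Prod>u\<in>U - {u}. 1 - load es x (Suc t) u)"
      using vU by (intro prod.cong) (auto simp: load)
    also have "(1 - load es x (Suc t) u) * \<dots> = (\<Prod>u\<in>U. 1 - load es x (Suc t) u)"
      by (simp add: prod.remove[OF fin 1])
    also have "load es x t z = load es x (Suc t) z"
      using U(2)[OF 1] zu by (simp add: load)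
    finally show ?thesis .
  next
    case 2
    \<comment> \<open>Now \<open>z\<close> can die, but only if \<open>u\<close> is alive as well.
      The lost probability therefore calls for the induction hypothesis at
      \<open>insert u U\<close>, admissible because the edge \<open>(z, u)\<close> arrives only
      now.\<close>
    have U': "insert u U \<subseteq> B" "\<forall>u\<in>insert u U. (z, u) \<notin> set (take t es)"
      using Suc.prems(3) e U(1) new 2 by auto
    have P: "(\<Prod>u\<in>U. 1 - load es x (Suc t) u) = (\<Prod>u\<in>U. 1 - load es x t u)"
      using 2 vU by (intro prod.cong) (auto simp: load)
    have "?E (Suc t) (\<lambda>s. of_bool (z \<in> snd s \<and> U \<subseteq> snd s))
        = ?E t (\<lambda>s. of_bool (z \<in> snd s \<and> U \<subseteq> snd s)
            - ?q * ?c * of_bool (z \<in> snd s \<and> insert u U \<subseteq> snd s))"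
      unfolding step
      by (rule Bochner_Integration.integral_cong[OF refl])
         (use 2 zu in \<open>auto split: prod.splits simp: algebra_simps\<close>)
    also have "\<dots> = ?E t (\<lambda>s. of_bool (z \<in> snd s \<and> U \<subseteq> snd s))
        - ?q * ?c * ?E t (\<lambda>s. of_bool (z \<in> snd s \<and> insert u U \<subseteq> snd s))"
      by (subst Bochner_Integration.integral_diff)
         (simp_all add: integrable_measure_pmf_finite[OF finite_set_rounding_state])
    also have "\<dots> = (1 - load es x t z / 2) * (\<Prod>u\<in>U. 1 - load es x t u)
        * (1 - ?q * (1 - load es x t u) * ?c)"
      unfolding IH[OF Suc.prems(3) U(1)] IH[OF U'] prod.insert[OF fin 2(1)]
      by (simp only: algebra_simps)
    also have "\<dots> = ((1 - load es x t z / 2) * (1 - x (v, u) * ?c))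
        * (\<Prod>u\<in>U. 1 - load es x t u)"
      unfolding q by simp
    \<comment> \<open>Since \<open>1 - load / 2\<close> is half of \<open>2 - load\<close>, the
      denominator of \<open>?c\<close> cancels and leaves a decrease of
      \<open>x (v, u) / 2\<close>.\<close>
    also have "(1 - load es x t z / 2) * (1 - x (v, u) * ?c) = 1 - load es x (Suc t) z / 2"
      using load_le_1[of z t] \<open>z \<in> A\<close> 2 by (simp add: load field_simps)
    finally show ?thesis by (simp add: P)
  next
    case 3
    \<comment> \<open>The edge touches neither \<open>z\<close> nor \<open>U\<close>, so the event
      is unaffected.\<close>
    have "?E (Suc t) (\<lambda>s. of_bool (z \<in> snd s \<and> U \<subseteq> snd s))
        = ?E t (\<lambda>s. of_bool (z \<in> snd s \<and> U \<subseteq> snd s) :: real)"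
      unfolding step
      by (rule Bochner_Integration.integral_cong[OF refl])
         (use 3 zu vU in \<open>auto split: prod.splits simp: algebra_simps\<close>)
    also have "\<dots> = (1 - load es x t z / 2) * (\<Prod>u\<in>U. 1 - load es x t u)"
      by (rule IH[OF Suc.prems(3) U(1)])
    also have "(\<Prod>u\<in>U. 1 - load es x t u) = (\<Prod>u\<in>U. 1 - load es x (Suc t) u)"
      using 3 vU by (intro prod.cong) (auto simp: load)
    also have "load es x t z = load es x (Suc t) z"
      using 3 zu by (simp add: load)
    finally show ?thesis .
  qed
qed

text \<open>The edge is decided once, at its arrival. The two survival factors cancel the
  denominators of \<open>?q\<close> and \<open>?c\<close> up to 1/2, which explains the acceptance
  probability \<open>1 / (2 - \<alpha>\<^sub>v)\<close>.\<close>

lemma rounding_edge_probability: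
  assumes "t \<le> length es" "e \<in> set (take t es)"
  shows "measure_pmf.expectation (rounding_state A B es p x t) (\<lambda>s. of_bool (e \<in> fst s))
    = x e / 2"
  using assms
proof (induction t)
  case 0
  then show ?case by simp
next
  case (Suc t)
  let ?E = "\<lambda>t. measure_pmf.expectation (rounding_state A B es p x t)"
  obtain v u where vu: "es ! t = (v, u)" by fastforce
  have t: "t < length es" using Suc.prems by simp
  note vuE = nth_edge[OF inst t vu]
  note step = rounding_expectation_Suc[OF t vu]
  show ?case
  proof (cases "e = (v, u)")
    case False
    then have "e \<in> set (take t es)" using Suc.prems by (simp add: set_take_Suc[OF t] vu)
    moreover have "?E (Suc t) (\<lambda>s. of_bool (e \<in> fst s)) = ?E t (\<lambda>s. of_bool (e \<in> fst s) :: real)"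
      unfolding step
      by (rule Bochner_Integration.integral_cong[OF refl])
         (use False in \<open>auto split: prod.splits simp: algebra_simps\<close>)
    ultimately show ?thesis using Suc.IH t by simp
  next
    case True
    let ?q = "x (v, u) / (1 - load es x t u)" and ?c = "1 / (2 - load es x t v)"
    have new: "(v, u) \<notin> set (take t es)"
      using nth_notin_set_take[OF distinct_edges[OF inst] t] vu by simp
    have "?E (Suc t) (\<lambda>s. of_bool (e \<in> fst s))
        = ?E t (\<lambda>s. ?q * ?c * of_bool (v \<in> snd s \<and> {u} \<subseteq> snd s))"
      unfolding step
    proof (rule expectation_pmf_cong)
      fix s assume s: "s \<in> set_pmf (rounding_state A B es p x t)"
      obtain M a where Ma: "s = (M, a)" by fastforce
      have "(v, u) \<notin> M"
        using rounding_state_matching[of t es M a A B p x] s Ma t new by (auto simp: is_matching_def)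
      then show "(case s of (M, a) \<Rightarrow>
        if u \<in> a then
          ?q * (if v \<in> a then ?c * of_bool (e \<in> fst (insert (v, u) M, a - {v} - {u}))
                  + (1 - ?c) * of_bool (e \<in> fst (M, a - {u}))
               else of_bool (e \<in> fst (M, a - {u})))
          + (1 - ?q) * of_bool (e \<in> fst (M, a))
        else of_bool (e \<in> fst (M, a))) = ?q * ?c * of_bool (v \<in> snd s \<and> {u} \<subseteq> snd s)"
        by (simp add: Ma True)
    qed
    \<comment> \<open>Joint survival is the case \<open>U = {u}\<close>: the edge from
      \<open>v\<close> to \<open>u\<close> is not among the earlier ones.\<close>
    also have "\<dots> = ?q * ?c * ((1 - load es x t v / 2) * (1 - load es x t u))"
      using expectation_alive[of t v "{u}"] vuE t new by simp
    also have "\<dots> = (?q * (1 - load es x t u)) * (?c * (1 - load es x t v / 2))"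
      by simp
    also have "?q * (1 - load es x t u) = x (v, u)"
      using edge_value_le(2)[OF t vu] edge_value[OF vuE(1)] by auto
    also have "?c * (1 - load es x t v / 2) = 1 / 2"
      using load_le_1[of v t] vuE by (simp add: field_simps)
    finally show ?thesis by (simp add: True)
  qed
qed

lemma edge_rounding_matching:
  "M \<in> set_pmf (edge_rounding A B es p x) \<Longrightarrow> is_matching (set es) M"
  using rounding_state_matching[OF order_refl] by (fastforce simp: edge_rounding_def)

lemma expectation_edge_rounding:
  "measure_pmf.expectation (edge_rounding A B es p x) (\<lambda>M. \<Sum>e\<in>M. w e)
    = (\<Sum>e\<in>set es. w e * x e) / 2"
proof -
  have "measure_pmf.expectation (edge_rounding A B es p x) (\<lambda>M. \<Sum>e\<in>M. w e)
    = (\<Sum>e\<in>set es. w e * measure_pmf.expectation (edge_rounding A B es p x) (\<lambda>M. of_bool (e \<in> M)))"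
    using edge_rounding_matching
    by (intro expectation_sum_random_set)
       (auto simp: edge_rounding_def finite_set_rounding_state is_matching_def)
  also have "\<dots> = (\<Sum>e\<in>set es. w e * (x e / 2))"
    by (simp add: edge_rounding_def rounding_edge_probability)
  finally show ?thesis by (simp add: sum_divide_distrib)
qed

end

theorem theorem2:
  fixes A B :: "'v set" and es :: "'v edge list" and w p x :: "'v edge \<Rightarrow> real"
  assumes "instance_E A B es w p"
    and "optimal_LPE A B es w p x"
  shows "(\<forall>M\<in>set_pmf (edge_rounding A B es p x). is_matching (set es) M) \<and>
    measure_pmf.expectation (edge_rounding A B es p x) (\<lambda>M. \<Sum>e\<in>M. w e) \<ge> OPT es w p / 2"
proof -
  have "feasible_LPE A B es p x" using assms(2) by (simp add: optimal_LPE_def)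
  \<comment> \<open>Rounding earns exactly half of the LP value, which is at least
    \<open>OPT es w p\<close>.\<close>
  then show ?thesis
    using edge_rounding_matching[OF assms(1)] expectation_edge_rounding[OF assms(1)]
      OPT_le_LPE[OF assms] by auto
qed

end
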